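(* For each of the rank two exceptional complex reflection groups $G_4,G_5,\dots,G_{22}$ (Shephard–Todd numbering), acting on $\mathbb{C}^2$ by their reflection representations, the reflection length and codimension functions do not coincide: there is an element $g$ with $\ell(g)>\operatorname{codim}(g)$.
   Context: A reflection is an element of $GL(V)$ of finite order fixing a hyperplane pointwise. $\ell(g)$ is the minimal number of reflections in the group whose product is $g$ ($\ell(1)=0$), and $\operatorname{codim}(g)=2-\dim\{v\in\mathbb{C}^2:gv=v\}$. *)

theory Defs
  imports "HOL-Analysis.Analysis"
begin

text \<open>Matrices acting on \<open>\<complex>^2\<close> are modelled as \<open>complex^2^2\<close>, acting by \<open>*v\<close>.\<close>

type_synonym cmat2 = "complex^2^2"

definition mat2 :: "complex \<Rightarrow> complex \<Rightarrow> complex \<Rightarrow> complex \<Rightarrow> cmat2" where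
  "mat2 p q r s = (\<chi> i j. if i = 1 then (if j = 1 then p else q) else (if j = 1 then r else s))"

text \<open>The unit quaternion a + bi + cj + dk as an element of SU(2).\<close>
definition quat :: "real \<Rightarrow> real \<Rightarrow> real \<Rightarrow> real \<Rightarrow> cmat2" where
  "quat a b c d = mat2 (Complex a b) (Complex c d) (Complex (-c) d) (Complex a (-b))"

definition tau :: real where "tau = (1 + sqrt 5) / 2"

text \<open>The matrix \<open>exp(2 pi i k/m) * quat a b c d\<close>.\<close>
definition refl_gen :: "nat \<Rightarrow> nat \<Rightarrow> real \<Rightarrow> real \<Rightarrow> real \<Rightarrow> real \<Rightarrow> cmat2" where
  "refl_gen k m a b c d = (\<chi> i j. cis (2 * pi * real k / real m) * (quat a b c d) $ i $ j)"

text \<open>Subgroup of GL_2(C) generated by a set S of invertible matrices.\<close>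
inductive_set gen_group :: "cmat2 set \<Rightarrow> cmat2 set" for S :: "cmat2 set" where
  one: "mat 1 \<in> gen_group S"
| mul: "s \<in> S \<Longrightarrow> g \<in> gen_group S \<Longrightarrow> s ** g \<in> gen_group S"
| mul_inv: "s \<in> S \<Longrightarrow> t ** s = mat 1 \<Longrightarrow> g \<in> gen_group S \<Longrightarrow> t ** g \<in> gen_group S"

text \<open>Generating reflections of the Shephard--Todd groups G_4, ..., G_22 (entry n-4 is G_n).
  Each generator is (root of unity) * (element of the binary tetrahedral / octahedral /
  icosahedral group).\<close>
definition ST_gens_list :: "cmat2 list list" where
  "ST_gens_list = [
     [refl_gen 1 3 (-1/2) (1/2) (-1/2) (-1/2), refl_gen 1 3 (-1/2) (1/2) (1/2) (1/2), refl_gen 2 3 (-1/2) (1/2) (-1/2) (1/2)],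
     [refl_gen 2 3 (-1/2) (-1/2) (-1/2) (-1/2), refl_gen 2 3 (-1/2) (1/2) (-1/2) (-1/2)],
     [refl_gen 1 4 (0) (0) (0) (1), refl_gen 1 3 (-1/2) (-1/2) (-1/2) (-1/2)],
     [refl_gen 2 3 (-1/2) (-1/2) (-1/2) (-1/2), refl_gen 1 3 (-1/2) (-1/2) (1/2) (1/2), refl_gen 1 4 (0) (-1) (0) (0)],
     [refl_gen 3 8 (-1/sqrt 2) (1/sqrt 2) (0) (0), refl_gen 1 8 (1/sqrt 2) (0) (0) (1/sqrt 2)],
     [refl_gen 1 8 (1/sqrt 2) (1/sqrt 2) (0) (0), refl_gen 1 4 (0) (-1/sqrt 2) (0) (1/sqrt 2)],
     [refl_gen 2 3 (-1/2) (1/2) (-1/2) (-1/2), refl_gen 1 3 (-1/2) (-1/2) (-1/2) (-1/2), refl_gen 1 8 (1/sqrt 2) (0) (-1/sqrt 2) (0)],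
     [refl_gen 2 3 (-1/2) (-1/2) (1/2) (1/2), refl_gen 1 8 (1/sqrt 2) (0) (0) (1/sqrt 2), refl_gen 1 4 (0) (-1/sqrt 2) (0) (-1/sqrt 2)],
     [refl_gen 1 4 (0) (-1/sqrt 2) (0) (-1/sqrt 2), refl_gen 1 4 (0) (1/sqrt 2) (0) (-1/sqrt 2), refl_gen 1 4 (0) (0) (-1/sqrt 2) (-1/sqrt 2)],
     [refl_gen 1 4 (0) (-1/sqrt 2) (0) (-1/sqrt 2), refl_gen 1 4 (0) (0) (0) (1), refl_gen 1 4 (0) (-1/sqrt 2) (-1/sqrt 2) (0)],
     [refl_gen 1 3 (-1/2) (-1/2) (1/2) (1/2), refl_gen 2 3 (-1/2) (-1/2) (-1/2) (1/2), refl_gen 1 4 (0) (-1/sqrt 2) (0) (1/sqrt 2)],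
     [refl_gen 1 4 (0) (1) (0) (0), refl_gen 2 3 (-1/2) (1/2) (-1/2) (-1/2), refl_gen 1 4 (0) (-1/sqrt 2) (0) (-1/sqrt 2)],
     [refl_gen 1 5 (1/(2*tau)) (1/2) (-tau/2) (0), refl_gen 4 5 (1/(2*tau)) (0) (1/2) (-tau/2)],
     [refl_gen 1 4 (0) (tau/2) (1/2) (-1/(2*tau)), refl_gen 1 5 (1/(2*tau)) (tau/2) (0) (1/2)],
     [refl_gen 1 3 (-1/2) (-1/(2*tau)) (0) (tau/2), refl_gen 1 5 (1/(2*tau)) (0) (1/2) (-tau/2)],
     [refl_gen 3 5 (-tau/2) (0) (1/(2*tau)) (1/2), refl_gen 2 3 (-1/2) (-1/2) (-1/2) (-1/2), refl_gen 1 4 (0) (1/(2*tau)) (tau/2) (-1/2)],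
     [refl_gen 1 3 (-1/2) (tau/2) (-1/(2*tau)) (0), refl_gen 2 3 (-1/2) (1/2) (-1/2) (-1/2)],
     [refl_gen 2 3 (-1/2) (-1/2) (1/2) (-1/2), refl_gen 1 4 (0) (0) (0) (-1), refl_gen 1 4 (0) (-1/(2*tau)) (tau/2) (-1/2)],
     [refl_gen 1 4 (0) (-1/(2*tau)) (-tau/2) (-1/2), refl_gen 1 4 (0) (1/(2*tau)) (-tau/2) (1/2), refl_gen 1 4 (0) (1/2) (-1/(2*tau)) (-tau/2)]
  ]"

definition ST_group :: "nat \<Rightarrow> cmat2 set" where
  "ST_group n = gen_group (set (ST_gens_list ! (n - 4)))"

definition mpow :: "cmat2 \<Rightarrow> nat \<Rightarrow> cmat2" where
  "mpow g k = ((\<lambda>h. g ** h) ^^ k) (mat 1)"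

text \<open>A reflection: an element of GL(C^2), not the identity, of finite order,
  fixing a hyperplane (a 1-dimensional complex subspace) pointwise.\<close>
definition is_reflection :: "cmat2 \<Rightarrow> bool" where
  "is_reflection g \<longleftrightarrow> invertible g \<and> g \<noteq> mat 1 \<and> (\<exists>k>0. mpow g k = mat 1) \<and>
     (\<exists>H. vec.subspace H \<and> vec.dim H = 1 \<and> (\<forall>v\<in>H. g *v v = v))"

text \<open>Reflection length with respect to the reflections of G.\<close>
definition refl_length :: "cmat2 set \<Rightarrow> cmat2 \<Rightarrow> nat" where
  "refl_length G g = (LEAST k. \<exists>rs. length rs = k \<and> set rs \<subseteq> {r \<in> G. is_reflection r} \<and>
       g = foldr (**) rs (mat 1))"

definition codim :: "cmat2 \<Rightarrow> nat" where
  "codim g = 2 - vec.dim {v :: complex^2. g *v v = v}"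

end

theory Submission
  imports Defs
begin

text \<open>Every \<open>g\<close> has \<open>codim g \<le> 2\<close>, so it suffices to find in each group an element that is neither
  \<open>1\<close>, nor a reflection, nor a product of two reflections of the group. A matrix \<open>r \<noteq> 1\<close> of finite
  order in \<open>GL\<^sub>2(\<complex>)\<close> is a reflection iff \<open>tr r = 1 + det r\<close> and \<open>det r \<noteq> 1\<close>. Three kinds of
  witnesses are used.
  For most groups some power of a product of two generators is a scalar \<open>\<lambda> \<noteq> 1\<close>. If
  \<open>\<lambda> = r\<^sub>1 r\<^sub>2\<close> with reflections \<open>r\<^sub>i\<close> then \<open>det r\<^sub>1 = \<lambda>\<close>, which is impossible when all determinants in
  the group are \<open>d\<close>-th roots of unity but \<open>\<lambda>\<^sup>d \<noteq> 1\<close>.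
  For \<open>G\<^sub>1\<^sub>2\<close>, \<open>G\<^sub>1\<^sub>3\<close> and \<open>G\<^sub>2\<^sub>2\<close> all reflections have determinant \<open>-1\<close>, hence trace \<open>0\<close>, and the product
  of the three generators has determinant \<open>-1\<close> and nonzero trace.
  For \<open>G\<^sub>8\<close>, \<open>G\<^sub>1\<^sub>0\<close> and \<open>G\<^sub>1\<^sub>4\<close> the group lies in the finite group of roots of unity times the
  binary octahedral group, and a finite search there certifies a suitable element.\<close>

section \<open>Matrices of size two\<close>

definition scale_mat :: "complex \<Rightarrow> cmat2 \<Rightarrow> cmat2" where
  "scale_mat w M = (\<chi> i j. w * M $ i $ j)"

lemma cmat2_eq_iff:
  "(M::cmat2) = N \<longleftrightarrow> M$1$1 = N$1$1 \<and> M$1$2 = N$1$2 \<and> M$2$1 = N$2$1 \<and> M$2$2 = N$2$2"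
  by (auto simp: vec_eq_iff forall_2)

lemma vec2_eq_iff: "(v::complex^2) = w \<longleftrightarrow> v$1 = w$1 \<and> v$2 = w$2"
  by (auto simp: vec_eq_iff forall_2)

lemma matrix_matrix_mult_entry2: "((A::cmat2) ** B)$i$j = A$i$1 * B$1$j + A$i$2 * B$2$j"
  by (simp add: matrix_matrix_mult_def sum_2)

lemma matrix_vector_mult_entry2: "((M::cmat2) *v v)$i = M$i$1 * v$1 + M$i$2 * v$2"
  by (simp add: matrix_vector_mult_def sum_2)

lemma mat1_entries2:
  "(mat 1 :: cmat2)$1$1 = 1" "(mat 1 :: cmat2)$1$2 = 0" "(mat 1 :: cmat2)$2$1 = 0" "(mat 1 :: cmat2)$2$2 = 1"
  by (simp_all add: mat_def)

lemma mat2_entries [simp]: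
  "mat2 p q r s $1$1 = p" "mat2 p q r s $1$2 = q" "mat2 p q r s $2$1 = r" "mat2 p q r s $2$2 = s"
  by (simp_all add: mat2_def)

lemma scale_mat_entry [simp]: "scale_mat w M $i$j = w * M$i$j"
  by (simp add: scale_mat_def)

lemma trace2: "trace (M::cmat2) = M$1$1 + M$2$2"
  by (simp add: trace_def UNIV_2)

lemma mat2_eq_mat1_iff: "mat2 p q r s = mat 1 \<longleftrightarrow> p = 1 \<and> q = 0 \<and> r = 0 \<and> s = 1"
  by (auto simp: cmat2_eq_iff mat1_entries2)

lemma scale_mat_mult: "scale_mat w A ** scale_mat w' B = scale_mat (w * w') (A ** B)"
  by (simp add: cmat2_eq_iff matrix_matrix_mult_entry2 algebra_simps)

lemma trace_scale_mat: "trace (scale_mat w M) = w * trace M"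
  by (simp add: trace2 algebra_simps)

lemma det_scale_mat: "det (scale_mat w M) = w^2 * det M"
  by (simp add: det_2 power2_eq_square algebra_simps)

lemma mpow_0 [simp]: "mpow M 0 = mat 1"
  and mpow_Suc: "mpow M (Suc n) = M ** mpow M n"
  by (simp_all add: mpow_def)

text \<open>Cayley--Hamilton: with \<open>u k = (\<alpha>^k - \<beta>^k)/(\<alpha> - \<beta>)\<close> one has
  \<open>M^(k+1) = u (k+1) M - \<alpha>\<beta> u k\<close>, and \<open>u n = 0\<close>, \<open>\<alpha>\<beta> u (n-1) = -l\<close>.\<close>
lemma mpow_eq_scalar:
  assumes tr: "trace M = \<alpha> + \<beta>" and dt: "det M = \<alpha> * \<beta>" and "\<alpha> \<noteq> \<beta>"
    and "\<alpha>^n = l" "\<beta>^n = l" "n > 0"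
  shows "mpow M n = mat2 l 0 0 l"
proof -
  define u where "u k = (\<alpha>^k - \<beta>^k)/(\<alpha> - \<beta>)" for k
  have ab: "\<alpha> - \<beta> \<noteq> 0" using \<open>\<alpha> \<noteq> \<beta>\<close> by simp
  have u_rec: "u (Suc (Suc k)) = (\<alpha>+\<beta>) * u (Suc k) - \<alpha>*\<beta> * u k" for k
  proof -
    have "\<alpha>^Suc (Suc k) - \<beta>^Suc (Suc k)
          = (\<alpha>+\<beta>) * (\<alpha>^Suc k - \<beta>^Suc k) - \<alpha>*\<beta> * (\<alpha>^k - \<beta>^k)"
      by (simp add: algebra_simps)
    then show ?thesis unfolding u_def by (simp add: diff_divide_distrib[symmetric])
  qed
  have t: "M$1$1 + M$2$2 = \<alpha> + \<beta>" and d: "M$1$1*M$2$2 - M$1$2*M$2$1 = \<alpha>*\<beta>"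
    using tr dt by (simp_all add: trace2 det_2)
  have pw: "mpow M (Suc k) = mat2 (u (Suc k) * M$1$1 - \<alpha>*\<beta>*u k) (u (Suc k) * M$1$2)
                                 (u (Suc k) * M$2$1) (u (Suc k) * M$2$2 - \<alpha>*\<beta>*u k)" for k
  proof (induction k)
    case 0
    show ?case using ab by (simp add: u_def mpow_Suc cmat2_eq_iff matrix_matrix_mult_entry2 mat1_entries2)
  next
    case (Suc k)
    show ?case
      unfolding mpow_Suc[of M "Suc k"] Suc.IH cmat2_eq_iff matrix_matrix_mult_entry2 mat2_entries u_rec
      using t d by (intro conjI; algebra)
  qed
  obtain k where k: "n = Suc k" using \<open>n > 0\<close> by (cases n) auto
  have "u n = 0" unfolding u_def using assms by simp
  moreover have "\<alpha>*\<beta>*u k = - l" unfolding u_def using ab assms unfolding k by (simp add: field_simps)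
  ultimately show ?thesis using pw[of k] unfolding k by simp
qed

lemma cmat2_eq_mat2: "(M::cmat2) = mat2 (M$1$1) (M$1$2) (M$2$1) (M$2$2)"
  by (simp add: cmat2_eq_iff)

lemma mpow_unipotent:
  assumes "trace M = 2" and "det M = 1"
  shows "mpow M n = mat 1 + scale_mat (of_nat n) (M - mat 1)"
proof (induction n)
  case 0
  show ?case by (simp add: cmat2_eq_iff)
next
  case (Suc n)
  define a b c d where "a = M$1$1" "b = M$1$2" "c = M$2$1" "d = M$2$2"
  have d: "d = 2 - a" and bc: "b * c = a * (2 - a) - 1"
    using assms unfolding a_b_c_d_def trace2 det_2
    by (metis add_diff_cancel_left', metis add_diff_cancel_left' diff_add_cancel)
  then have "of_nat n * (b * c) = of_nat n * (a * (2 - a) - 1)" by simp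
  then show ?case
    unfolding mpow_Suc Suc.IH cmat2_eq_iff matrix_matrix_mult_entry2
    by (simp add: mat1_entries2 a_b_c_d_def[symmetric] d algebra_simps)
qed

section \<open>Reflections of \<open>\<complex>\<^sup>2\<close>\<close>

lemma fixed_vector_iff_trace:
  fixes M :: cmat2
  shows "(\<exists>v. v \<noteq> 0 \<and> M *v v = v) \<longleftrightarrow> trace M = 1 + det M"
proof -
  have "(\<exists>v. v \<noteq> 0 \<and> M *v v = v) \<longleftrightarrow> \<not> invertible (M - mat 1)"
    by (auto simp: invertible_left_inverse matrix_left_invertible_ker matrix_vector_mult_diff_rdistrib)
  also have "\<dots> \<longleftrightarrow> det (M - mat 1) = 0"
    by (simp add: invertible_det_nz)
  also have "det (M - mat 1) = det M - trace M + 1"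
    by (simp add: det_2 trace2 mat1_entries2 algebra_simps)
  finally show ?thesis by (auto simp: algebra_simps)
qed

lemma reflection_trace: "is_reflection r \<Longrightarrow> trace r = 1 + det r"
proof -
  assume "is_reflection r"
  then obtain H where H: "vec.dim H = 1" "\<forall>v\<in>H. r *v v = v"
    unfolding is_reflection_def by blast
  then obtain v where "v \<in> H" "v \<noteq> 0"
    using vec.dim_eq_0[of H] by auto
  then show ?thesis
    using H(2) fixed_vector_iff_trace by blast
qed

lemma reflection_det_neq_1: "is_reflection r \<Longrightarrow> det r \<noteq> 1"
proof
  assume r: "is_reflection r" and d: "det r = 1"
  then obtain k where "k > 0" "mpow r k = mat 1"
    unfolding is_reflection_def by blast
  moreover have "trace r = 2" using reflection_trace[OF r] d by simp
  ultimately have "scale_mat (of_nat k) (r - mat 1) = 0"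
    using mpow_unipotent[of r k] d by simp
  then have "r = mat 1"
    using \<open>k > 0\<close> by (simp add: cmat2_eq_iff mat1_entries2)
  then show False using r unfolding is_reflection_def by blast
qed

lemma is_reflectionI:
  assumes tr: "trace M = 1 + det M" and "det M \<noteq> 1" and "det M ^ m = 1" and "m > 0"
  shows "is_reflection M"
proof -
  have "det M \<noteq> 0" using assms(3,4) by (auto simp: power_0_left)
  then have "invertible M" by (simp add: invertible_det_nz)
  moreover have "M \<noteq> mat 1" using \<open>det M \<noteq> 1\<close> by auto
  moreover have "mpow M m = mat 1"
    using mpow_eq_scalar[of M 1 "det M" m 1] assms by (simp add: mat2_eq_mat1_iff)
  moreover obtain v where v: "v \<noteq> 0" "M *v v = v"
    using tr fixed_vector_iff_trace by blast
  have "vec.dim (vec.span {v}) = 1"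
    using v(1) by (simp add: vec.dim_span_eq_card_independent vec.independent_insertI vec.independent_empty)
  moreover have "\<forall>w\<in>vec.span {v}. M *v w = w"
    using v(2) by (auto simp: vec.span_singleton vector_scalar_commute)
  ultimately show ?thesis
    unfolding is_reflection_def using \<open>m > 0\<close> by blast
qed

section \<open>Elements of reflection length at least three\<close>

lemma gen_group_generator: "s \<in> S \<Longrightarrow> s \<in> gen_group S"
  using gen_group.mul[OF _ gen_group.one] by (simp add: matrix_mul_rid)

lemma foldr_mult_in_gen_group: "set w \<subseteq> S \<Longrightarrow> foldr (**) w (mat 1) \<in> gen_group S"
  by (induction w) (auto intro: gen_group.intros)

lemma mpow_mult_eq_foldr: "mpow (s1 ** s2) n = foldr (**) (concat (replicate n [s1, s2])) (mat 1)"
  by (induction n) (simp_all add: mpow_Suc matrix_mul_assoc)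

lemma det_pow_gen_group:
  assumes "\<forall>s\<in>S. det s ^ d = 1" and "g \<in> gen_group S"
  shows "det g ^ d = 1"
  using assms(2)
proof (induction rule: gen_group.induct)
  case one
  then show ?case by simp
next
  case (mul s g)
  then show ?case using assms(1) by (simp add: det_mul power_mult_distrib)
next
  case (mul_inv s t g)
  have "det t * det s = 1" using \<open>t ** s = mat 1\<close> by (metis det_I det_mul)
  then have "det t ^ d = 1" using assms(1) \<open>s \<in> S\<close> by (metis power_mult_distrib power_one mult_1_right)
  then show ?case using mul_inv.IH by (simp add: det_mul power_mult_distrib)
qed

lemma codim_le_2: "codim g \<le> 2"
  by (simp add: codim_def)

lemma refl_length_ge_3:
  assumes "set w \<subseteq> {r \<in> G. is_reflection r}" and "g = foldr (**) w (mat 1)"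
    and "g \<noteq> mat 1" and "\<not> is_reflection g"
    and "\<And>r1 r2. r1 \<in> G \<Longrightarrow> is_reflection r1 \<Longrightarrow> r2 \<in> G \<Longrightarrow> is_reflection r2 \<Longrightarrow> r1 ** r2 \<noteq> g"
  shows "3 \<le> refl_length G g"
proof -
  let ?P = "\<lambda>k. \<exists>rs. length rs = k \<and> set rs \<subseteq> {r \<in> G. is_reflection r} \<and> g = foldr (**) rs (mat 1)"
  have "?P (Least ?P)" by (rule LeastI[of ?P "length w"]) (use assms(1,2) in blast)
  then obtain rs where rs: "length rs = refl_length G g" "set rs \<subseteq> {r \<in> G. is_reflection r}"
      "g = foldr (**) rs (mat 1)"
    unfolding refl_length_def by blast
  consider "rs = []" | r where "rs = [r]" | r1 r2 where "rs = [r1, r2]" | r1 r2 r3 rs' where "rs = r1 # r2 # r3 # rs'"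
    by (metis list.exhaust)
  then show ?thesis
    by cases (use rs assms(3-5) in \<open>auto simp: matrix_mul_rid\<close>)
qed

lemma long_element_in_gen_group:
  assumes "\<forall>s\<in>S. is_reflection s" and "set w \<subseteq> S" and "g = foldr (**) w (mat 1)"
    and "g \<noteq> mat 1" and "\<not> is_reflection g"
    and "\<And>r1 r2. r1 \<in> gen_group S \<Longrightarrow> is_reflection r1 \<Longrightarrow> r2 \<in> gen_group S \<Longrightarrow> is_reflection r2
           \<Longrightarrow> r1 ** r2 \<noteq> g"
  shows "\<exists>g \<in> gen_group S. codim g < refl_length (gen_group S) g"
proof -
  have "set w \<subseteq> {r \<in> gen_group S. is_reflection r}"
    using assms(1,2) gen_group_generator by blast
  then have "3 \<le> refl_length (gen_group S) g"
    using refl_length_ge_3 assms(3-6) by blast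
  moreover have "g \<in> gen_group S" using assms(2,3) foldr_mult_in_gen_group by blast
  ultimately show ?thesis using codim_le_2[of g] by force
qed

lemma scalar_not_reflection: "l \<noteq> 1 \<Longrightarrow> \<not> is_reflection (mat2 l 0 0 l)"
proof
  assume "l \<noteq> 1" and "is_reflection (mat2 l 0 0 l)"
  then have "(l - 1)^2 = 0"
    using reflection_trace[of "mat2 l 0 0 l"] by (simp add: trace2 det_2 power2_eq_square algebra_simps)
  then show False using \<open>l \<noteq> 1\<close> by simp
qed

text \<open>If \<open>r\<^sub>1 r\<^sub>2 = l\<close> then \<open>r\<^sub>2 = l r\<^sub>1\<^sup>-\<^sup>1\<close>, and the trace condition for \<open>r\<^sub>2\<close> becomes
  \<open>(l - 1)(det r\<^sub>1 - l) = 0\<close>.\<close>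
lemma det_reflection_mult_eq_scalar:
  assumes r1: "is_reflection r1" and r2: "is_reflection r2"
    and prod: "r1 ** r2 = mat2 l 0 0 l" and "l \<noteq> 1"
  shows "det r1 = l"
proof -
  define a b c d where "a = r1$1$1" "b = r1$1$2" "c = r1$2$1" "d = r1$2$2"
  define \<delta> where "\<delta> = det r1"
  have dt: "\<delta> = a*d - b*c" and t1: "a + d = 1 + \<delta>"
    using reflection_trace[OF r1] unfolding \<delta>_def a_b_c_d_def by (simp_all add: det_2 trace2)
  have dd: "\<delta> * det r2 = l * l"
    using arg_cong[OF prod, of det] unfolding \<delta>_def det_mul by (simp add: det_2)
  have e: "a * r2$1$1 + b * r2$2$1 = l" "a * r2$1$2 + b * r2$2$2 = 0"
          "c * r2$1$1 + d * r2$2$1 = 0" "c * r2$1$2 + d * r2$2$2 = l"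
    using prod unfolding cmat2_eq_iff matrix_matrix_mult_entry2 a_b_c_d_def by auto
  have "\<delta> * r2$1$1 = d * (a * r2$1$1 + b * r2$2$1) - b * (c * r2$1$1 + d * r2$2$1)"
       "\<delta> * r2$2$2 = a * (c * r2$1$2 + d * r2$2$2) - c * (a * r2$1$2 + b * r2$2$2)"
    unfolding dt by (simp_all add: algebra_simps)
  then have "\<delta> * r2$1$1 = d * l" "\<delta> * r2$2$2 = a * l"
    using e by simp_all
  then have "\<delta> * trace r2 = l * (a + d)" by (simp add: trace2 algebra_simps)
  then have "\<delta> + l * l = l * (1 + \<delta>)"
    using reflection_trace[OF r2] t1 dd by (simp add: algebra_simps)
  then have "(l - 1) * (\<delta> - l) = 0" by algebra
  then show ?thesis using \<open>l \<noteq> 1\<close> \<delta>_def by simp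
qed

lemma long_element_of_scalar_power:
  assumes gens: "\<forall>s\<in>S. is_reflection s \<and> det s ^ d = 1"
    and "s1 \<in> S" and "s2 \<in> S" and pow: "mpow (s1 ** s2) n = mat2 l 0 0 l" and "l ^ d \<noteq> 1"
  shows "\<exists>g \<in> gen_group S. codim g < refl_length (gen_group S) g"
proof (rule long_element_in_gen_group)
  show "\<forall>s\<in>S. is_reflection s" and "set (concat (replicate n [s1, s2])) \<subseteq> S"
    using gens \<open>s1 \<in> S\<close> \<open>s2 \<in> S\<close> by auto
  show "mat2 l 0 0 l = foldr (**) (concat (replicate n [s1, s2])) (mat 1)"
    using pow by (simp add: mpow_mult_eq_foldr)
  have "l \<noteq> 1" using \<open>l ^ d \<noteq> 1\<close> by auto
  then show "mat2 l 0 0 l \<noteq> mat 1" and "\<not> is_reflection (mat2 l 0 0 l)"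
    by (simp_all add: mat2_eq_mat1_iff scalar_not_reflection)
  fix r1 r2 assume "r1 \<in> gen_group S" "is_reflection r1" "is_reflection r2"
  then show "r1 ** r2 \<noteq> mat2 l 0 0 l"
    using det_reflection_mult_eq_scalar det_pow_gen_group[of S d r1] gens \<open>l ^ d \<noteq> 1\<close> \<open>l \<noteq> 1\<close>
    by blast
qed

lemma det_foldr_mult: "det (foldr (**) w (mat 1)) = (\<Prod>s\<leftarrow>w. det s)"
  by (induction w) (simp_all add: det_mul)

lemma long_element_of_det_minus_one:
  assumes gens: "\<forall>s\<in>S. is_reflection s \<and> det s ^ 2 = 1" and "set w \<subseteq> S"
    and "odd (length w)" and tr: "trace (foldr (**) w (mat 1)) \<noteq> 0"
  shows "\<exists>g \<in> gen_group S. codim g < refl_length (gen_group S) g"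
proof (rule long_element_in_gen_group[OF _ \<open>set w \<subseteq> S\<close> refl])
  show "\<forall>s\<in>S. is_reflection s" using gens by blast
  have det_refl: "det r = -1" if "r \<in> gen_group S" "is_reflection r" for r
    using det_pow_gen_group[of S 2 r] gens that reflection_det_neq_1 power2_eq_1_iff by blast
  have "\<forall>s\<in>set w. det s = -1"
    using \<open>set w \<subseteq> S\<close> gens det_refl gen_group_generator by blast
  then have "(\<Prod>s\<leftarrow>w. det s) = (-1) ^ length w" by (induction w) auto
  then have det: "det (foldr (**) w (mat 1)) = -1"
    using \<open>odd (length w)\<close> by (simp add: det_foldr_mult)
  show "foldr (**) w (mat 1) \<noteq> mat 1" using det by auto
  show "\<not> is_reflection (foldr (**) w (mat 1))"
    using reflection_trace det tr by fastforce
  fix r1 r2 assume "r1 \<in> gen_group S" "is_reflection r1" "r2 \<in> gen_group S" "is_reflection r2"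
  then show "r1 ** r2 \<noteq> foldr (**) w (mat 1)"
    using det det_refl by (metis det_mul mult_minus1_right minus_minus one_neq_neg_one)
qed

section \<open>Unit quaternions and the generators\<close>

lemma quat_entries [simp]:
  "quat a b c d $1$1 = Complex a b" "quat a b c d $1$2 = Complex c d"
  "quat a b c d $2$1 = Complex (-c) d" "quat a b c d $2$2 = Complex a (-b)"
  by (simp_all add: quat_def)

lemma quat_mult:
  "quat a b c d ** quat a' b' c' d' =
   quat (a*a' - b*b' - c*c' - d*d') (a*b' + b*a' + c*d' - d*c')
        (a*c' - b*d' + c*a' + d*b') (a*d' + b*c' - c*b' + d*a')"
  by (simp add: cmat2_eq_iff matrix_matrix_mult_entry2 complex_eq_iff algebra_simps)

lemma trace_quat: "trace (quat a b c d) = 2 * a"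
  by (simp add: trace2 complex_eq_iff)

lemma det_quat: "det (quat a b c d) = of_real (a^2 + b^2 + c^2 + d^2)"
  by (simp add: det_2 complex_eq_iff power2_eq_square algebra_simps)

lemma refl_gen_eq_scale_mat: "refl_gen k m a b c d = scale_mat (cis (2*pi*k/m)) (quat a b c d)"
  by (simp add: refl_gen_def scale_mat_def)

lemma cis_2pi_eq_1_iff:
  assumes "Q > 0"
  shows "cis (2*pi*(of_int a / of_int Q)) = 1 \<longleftrightarrow> Q dvd a"
proof
  assume "cis (2*pi*(of_int a / of_int Q)) = 1"
  then have "cos (2*pi*(of_int a / of_int Q)) = 1" by (metis cis.sel(1) one_complex.sel(1))
  then obtain n :: int where "2*pi*(of_int a / of_int Q) = n*2*pi"
    using cos_one_2pi_int by auto
  then have "a = Q * n" using assms by (simp add: field_simps flip: of_int_mult)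
  then show "Q dvd a" by simp
next
  assume "Q dvd a"
  then obtain n where "a = Q * n" ..
  then have "of_int a / of_int Q = (of_int n :: real)" using assms by simp
  then show "cis (2*pi*(of_int a / of_int Q)) = 1" by simp
qed

lemma det_refl_gen:
  "a^2 + b^2 + c^2 + d^2 = 1 \<Longrightarrow> det (refl_gen k m a b c d) = cis (2*pi*(of_int (2*k) / of_int m))"
  by (simp add: refl_gen_eq_scale_mat det_scale_mat det_quat power2_eq_square cis_mult)

lemma det_refl_gen_pow_eq_1:
  assumes "a^2 + b^2 + c^2 + d^2 = 1" and "m > 0" and "m dvd 2*k*e"
  shows "det (refl_gen k m a b c d) ^ e = 1"
proof -
  have "det (refl_gen k m a b c d) ^ e = cis (2*pi*(of_int (2*k*e) / of_int m))"
    using assms(1) by (simp add: det_refl_gen Complex.DeMoivre algebra_simps)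
  moreover have "int m dvd int (2*k*e)" using assms(3) by (simp only: int_dvd_int_iff)
  ultimately show ?thesis
    using cis_2pi_eq_1_iff[of "int m" "int (2*k*e)"] assms(2) by simp
qed

lemma is_reflection_refl_gen:
  assumes a: "a = cos (2*pi*k/m)" and norm: "a^2 + b^2 + c^2 + d^2 = 1"
    and "m > 0" and "\<not> m dvd 2*k"
  shows "is_reflection (refl_gen k m a b c d)"
proof (rule is_reflectionI)
  define \<theta> where "\<theta> = 2*pi*k/m"
  have det_eq: "det (refl_gen k m a b c d) = cis (2*\<theta>)"
    using det_refl_gen[OF norm] by (simp add: \<theta>_def)
  show "trace (refl_gen k m a b c d) = 1 + det (refl_gen k m a b c d)"
    unfolding det_eq unfolding refl_gen_eq_scale_mat trace_scale_mat trace_quat a \<theta>_def[symmetric]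
    using cos_double_cos[of \<theta>] sin_double[of \<theta>]
    by (simp add: complex_eq_iff power2_eq_square algebra_simps)
  show "det (refl_gen k m a b c d) ^ m = 1"
    using det_refl_gen_pow_eq_1[OF norm \<open>m > 0\<close>, of k m] by simp
  have "\<not> int m dvd int (2*k)" using assms(4) int_dvd_int_iff by blast
  then show "det (refl_gen k m a b c d) \<noteq> 1"
    using det_refl_gen[OF norm] cis_2pi_eq_1_iff[of "int m" "int (2*k)"] assms(3) by simp
qed (fact \<open>m > 0\<close>)

text \<open>The eigenvalues of \<open>q\<close> are \<open>cis x\<close> and \<open>cis (-x)\<close>.\<close>
lemma mpow_scale_mat_eq_scalar:
  assumes "det q = 1" and "trace q = 2 * of_real (cos x)"
    and "cis (2*x) \<noteq> 1" and "cis (n*(2*x)) = 1" and "n > 0"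
  shows "mpow (scale_mat (cis t) q) n = mat2 (cis (n*(t+x))) 0 0 (cis (n*(t+x)))"
proof (rule mpow_eq_scalar)
  show "trace (scale_mat (cis t) q) = cis (t+x) + cis (t-x)"
    using assms(2) by (simp add: trace_scale_mat complex_eq_iff cos_add cos_diff sin_add sin_diff)
  show "det (scale_mat (cis t) q) = cis (t+x) * cis (t-x)"
    using assms(1) by (simp add: det_scale_mat cis_mult power2_eq_square)
  show "cis (t+x) \<noteq> cis (t-x)"
    using \<open>cis (2*x) \<noteq> 1\<close> by (metis add_diff_cancel_left' cis_divide diff_diff_eq2 divide_self_if cis_neq_zero mult_2)
  show "cis (t+x) ^ n = cis (n*(t+x))" by (simp add: Complex.DeMoivre)
  have "cis (n*(t+x)) = cis (n*(t-x)) * cis (n*(2*x))" by (simp add: cis_mult algebra_simps)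
  then show "cis (t-x) ^ n = cis (n*(t+x))" using assms(4) by (simp add: Complex.DeMoivre)
qed (fact \<open>n > 0\<close>)

lemma reflection_scale_mat_unimodular:
  assumes r: "is_reflection (scale_mat (cis \<theta>) q)" and "det q = 1" and tr: "trace q = 2 * of_real c"
  shows "c = cos \<theta>" and "cis (2*\<theta>) \<noteq> 1"
proof -
  have det: "det (scale_mat (cis \<theta>) q) = cis (2*\<theta>)"
    using \<open>det q = 1\<close> by (simp add: det_scale_mat power2_eq_square cis_mult)
  then show "cis (2*\<theta>) \<noteq> 1" using reflection_det_neq_1[OF r] by simp
  have "cis \<theta> * (2 * of_real c) = 1 + cis (2*\<theta>)"
    using reflection_trace[OF r] by (simp add: det trace_scale_mat tr)
  then have "cis (-\<theta>) * (cis \<theta> * (2 * of_real c)) = cis (-\<theta>) + cis \<theta>"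
    by (simp add: distrib_left cis_mult)
  then have "2 * complex_of_real c = cis (-\<theta>) + cis \<theta>"
    by (simp add: cis_mult flip: mult.assoc)
  then have "Re (2 * complex_of_real c) = Re (cis (-\<theta>) + cis \<theta>)" by simp
  then show "c = cos \<theta>" by simp
qed

text \<open>The product of the two generators is \<open>cis (2\<pi>T/Q)\<close> times a unit quaternion with real part
  \<open>cos (2\<pi>P/Q)\<close>; its \<open>n\<close>-th power is the scalar \<open>cis (2\<pi>n(T+P)/Q)\<close>, which is not an \<open>e\<close>-th root
  of unity.\<close>
lemma long_element_of_generator_pair:
  assumes gens: "\<forall>s\<in>S. is_reflection s \<and> det s ^ e = 1"
    and "refl_gen k m a b c d \<in> S" and "refl_gen k' m' a' b' c' d' \<in> S"
    and norm: "a^2 + b^2 + c^2 + d^2 = 1" "a'^2 + b'^2 + c'^2 + d'^2 = 1"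
    and re: "a*a' - b*b' - c*c' - d*d' = cos (2*pi*(of_int P / of_int Q))"
    and angle: "real k / real m + real k' / real m' = of_int T / of_int Q"
    and "Q > 0" and "\<not> Q dvd 2*P" and "Q dvd 2*int n*P" and "\<not> Q dvd int e*int n*(T+P)"
  shows "\<exists>g \<in> gen_group S. codim g < refl_length (gen_group S) g"
proof (rule long_element_of_scalar_power[OF gens assms(2,3)])
  define x t where "x = 2*pi*(of_int P / of_int Q)" and "t = 2*pi*(of_int T / of_int Q)"
  let ?q = "quat a b c d ** quat a' b' c' d'"
  have "n \<noteq> 0" using \<open>\<not> Q dvd int e*int n*(T+P)\<close> by (cases n) auto
  have prod: "refl_gen k m a b c d ** refl_gen k' m' a' b' c' d' = scale_mat (cis t) ?q"
    unfolding refl_gen_eq_scale_mat scale_mat_mult cis_mult t_def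
    by (simp add: algebra_simps flip: angle)
  have "det ?q = 1" using norm by (simp add: det_mul det_quat)
  moreover have "cis (2*x) \<noteq> 1" "cis (n*(2*x)) = 1"
    using cis_2pi_eq_1_iff[OF \<open>Q > 0\<close>, of "2*P"] cis_2pi_eq_1_iff[OF \<open>Q > 0\<close>, of "2*int n*P"]
      \<open>\<not> Q dvd 2*P\<close> \<open>Q dvd 2*int n*P\<close>
    by (simp_all add: x_def algebra_simps)
  ultimately show "mpow (refl_gen k m a b c d ** refl_gen k' m' a' b' c' d') n
      = mat2 (cis (n*(t+x))) 0 0 (cis (n*(t+x)))"
    unfolding prod using re \<open>n \<noteq> 0\<close>
    by (intro mpow_scale_mat_eq_scalar) (simp_all add: x_def quat_mult trace_quat)
  have "cis (n*(t+x)) ^ e = cis (2*pi*(of_int (int e*int n*(T+P)) / of_int Q))"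
    by (simp add: Complex.DeMoivre x_def t_def algebra_simps add_divide_distrib)
  then show "cis (n*(t+x)) ^ e \<noteq> 1"
    using cis_2pi_eq_1_iff[OF \<open>Q > 0\<close>, of "int e*int n*(T+P)"] \<open>\<not> Q dvd int e*int n*(T+P)\<close>
    by simp
qed

section \<open>Trigonometric values\<close>

lemma cos_pi_fifth: "cos (pi/5) = (1 + sqrt 5)/4"
proof -
  define c where "c = cos (pi/5)"
  have "cos (3*(pi/5)) = - cos (2*(pi/5))"
    using cos_pi_minus[of "2*(pi/5)"] by (simp add: field_simps)
  then have "4*c^3 - 3*c = -(2*c^2 - 1)" unfolding c_def cos_treble_cos cos_double_cos .
  then have "(c + 1) * (4*c^2 - 2*c - 1) = 0" by (simp add: algebra_simps power3_eq_cube power2_eq_square)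
  moreover have "c > 0" unfolding c_def by (rule cos_gt_zero_pi) (use pi_gt_zero in linarith)+
  ultimately have "4*c^2 - 2*c - 1 = 0" by simp
  moreover have "(c - (1 + sqrt 5)/4) * (c - (1 - sqrt 5)/4) = c^2 - c/2 + (1 - sqrt 5 * sqrt 5)/16"
    by (simp add: field_simps power2_eq_square)
  ultimately have roots: "(c - (1 + sqrt 5)/4) * (c - (1 - sqrt 5)/4) = 0" by simp
  have "(1 - sqrt 5)/4 \<le> 0" by simp
  then have "c - (1 - sqrt 5)/4 \<noteq> 0" using \<open>c > 0\<close> by linarith
  with roots show ?thesis unfolding c_def by simp
qed

lemma tau_fractions: "tau/2 = (1 + sqrt 5)/4" "1/(2*tau) = (sqrt 5 - 1)/4"
proof -
  have "(1 + sqrt 5) * (sqrt 5 - 1) = 4" by (simp add: algebra_simps)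
  moreover have "1 + sqrt 5 > 0" by (simp add: add_pos_nonneg)
  ultimately show "1/(2*tau) = (sqrt 5 - 1)/4" unfolding tau_def by (simp add: field_simps)
qed (simp add: tau_def)

lemma cos_rational_angles [simp]:
  "cos (pi/3) = 1/2" "cos (pi/4) = 1/sqrt 2" "cos (3*pi/4) = -1/sqrt 2"
  "cos (2*pi/3) = -1/2" "cos (4*pi/3) = -1/2"
  "cos (2*pi/5) = (sqrt 5 - 1)/4" "cos (3*pi/5) = (1 - sqrt 5)/4"
  "cos (6*pi/5) = -(1 + sqrt 5)/4" "cos (8*pi/5) = (sqrt 5 - 1)/4"
proof -
  have double: "cos (2*pi/5) = (sqrt 5 - 1)/4"
    using cos_double_cos[of "pi/5"] by (simp add: cos_pi_fifth power2_eq_square field_simps)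
  show "cos (pi/3) = 1/2" by (fact cos_60)
  have "sqrt 2 / 2 = 1 / sqrt (2::real)" by (simp add: field_simps)
  then show "cos (pi/4) = 1/sqrt 2" using cos_45 by simp
  then show "cos (3*pi/4) = -1/sqrt 2" using cos_pi_minus[of "pi/4"] by (simp add: field_simps)
  show "cos (2*pi/3) = -1/2" using cos_pi_minus[of "pi/3"] by (simp add: cos_60 field_simps)
  show "cos (4*pi/3) = -1/2" using cos_periodic_pi[of "pi/3"] by (simp add: cos_60 field_simps)
  show "cos (2*pi/5) = (sqrt 5 - 1)/4" by (fact double)
  show "cos (3*pi/5) = (1 - sqrt 5)/4" using cos_pi_minus[of "2*pi/5"] double by (simp add: field_simps)
  show "cos (6*pi/5) = -(1 + sqrt 5)/4" using cos_periodic_pi[of "pi/5"] by (simp add: cos_pi_fifth field_simps)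
  show "cos (8*pi/5) = (sqrt 5 - 1)/4" using cos_2pi_minus[of "2*pi/5"] double by (simp add: field_simps)
qed

section \<open>The binary octahedral group\<close>

type_synonym int4 = "int \<times> int \<times> int \<times> int"
type_synonym oct = "bool \<times> int4"

text \<open>\<open>(True, x)\<close> stands for the quaternion \<open>x/2\<close> and \<open>(False, x)\<close> for \<open>x/\<surd>2\<close>, \<open>x \<in> \<int>\<^sup>4\<close>;
  \<open>binary_octahedral\<close> lists the 48 elements of the binary octahedral group in this form.\<close>
definition oct_scale :: "bool \<Rightarrow> real" where
  "oct_scale h = (if h then 1/2 else 1/sqrt 2)"

fun oct_quat :: "oct \<Rightarrow> cmat2" where
  "oct_quat (h, (x0, x1, x2, x3)) =
     quat (oct_scale h * x0) (oct_scale h * x1) (oct_scale h * x2) (oct_scale h * x3)"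

fun int4_mult :: "int4 \<Rightarrow> int4 \<Rightarrow> int4" where
  "int4_mult (a, b, c, d) (a', b', c', d') =
     (a*a' - b*b' - c*c' - d*d', a*b' + b*a' + c*d' - d*c',
      a*c' - b*d' + c*a' + d*b', a*d' + b*c' - c*b' + d*a')"

fun int4_even :: "int4 \<Rightarrow> bool" where
  "int4_even (a, b, c, d) \<longleftrightarrow> even a \<and> even b \<and> even c \<and> even d"

fun int4_half :: "int4 \<Rightarrow> int4" where
  "int4_half (a, b, c, d) = (a div 2, b div 2, c div 2, d div 2)"

definition oct_mult_ok :: "oct \<Rightarrow> oct \<Rightarrow> bool" where
  "oct_mult_ok p q \<longleftrightarrow> (fst p \<or> fst q \<longrightarrow> int4_even (int4_mult (snd p) (snd q)))"

text \<open>\<open>x/2 \<cdot> y/2 = (xy/2)/2\<close>, \<open>x/2 \<cdot> y/\<surd>2 = (xy/2)/\<surd>2\<close> and \<open>x/\<surd>2 \<cdot> y/\<surd>2 = xy/2\<close>;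
  \<open>oct_mult_ok\<close> says that the halving is exact.\<close>
definition oct_mult :: "oct \<Rightarrow> oct \<Rightarrow> oct" where
  "oct_mult p q = (fst p = fst q,
     if fst p \<or> fst q then int4_half (int4_mult (snd p) (snd q)) else int4_mult (snd p) (snd q))"

fun oct_conj :: "oct \<Rightarrow> oct" where
  "oct_conj (h, (x0, x1, x2, x3)) = (h, (x0, -x1, -x2, -x3))"

definition oct_one :: oct where
  "oct_one = (True, (2, 0, 0, 0))"

definition binary_octahedral :: "oct list" where
  "binary_octahedral =
    [(True, (-2, 0, 0, 0)), (True, (2, 0, 0, 0)), (True, (0, -2, 0, 0)), (True, (0, 2, 0, 0)),
     (True, (0, 0, -2, 0)), (True, (0, 0, 2, 0)), (True, (0, 0, 0, -2)), (True, (0, 0, 0, 2)),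
     (True, (-1, -1, -1, -1)), (True, (-1, -1, -1, 1)), (True, (-1, -1, 1, -1)), (True, (-1, -1, 1, 1)),
     (True, (-1, 1, -1, -1)), (True, (-1, 1, -1, 1)), (True, (-1, 1, 1, -1)), (True, (-1, 1, 1, 1)),
     (True, (1, -1, -1, -1)), (True, (1, -1, -1, 1)), (True, (1, -1, 1, -1)), (True, (1, -1, 1, 1)),
     (True, (1, 1, -1, -1)), (True, (1, 1, -1, 1)), (True, (1, 1, 1, -1)), (True, (1, 1, 1, 1)),
     (False, (-1, -1, 0, 0)), (False, (-1, 1, 0, 0)), (False, (1, -1, 0, 0)), (False, (1, 1, 0, 0)),
     (False, (-1, 0, -1, 0)), (False, (-1, 0, 1, 0)), (False, (1, 0, -1, 0)), (False, (1, 0, 1, 0)),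
     (False, (-1, 0, 0, -1)), (False, (-1, 0, 0, 1)), (False, (1, 0, 0, -1)), (False, (1, 0, 0, 1)),
     (False, (0, -1, -1, 0)), (False, (0, -1, 1, 0)), (False, (0, 1, -1, 0)), (False, (0, 1, 1, 0)),
     (False, (0, -1, 0, -1)), (False, (0, -1, 0, 1)), (False, (0, 1, 0, -1)), (False, (0, 1, 0, 1)),
     (False, (0, 0, -1, -1)), (False, (0, 0, -1, 1)), (False, (0, 0, 1, -1)), (False, (0, 0, 1, 1))]"

lemma oct_quat_mult_int4:
  "oct_quat (h, x) ** oct_quat (h', y) =
   (case int4_mult x y of (z0, z1, z2, z3) \<Rightarrow>
      quat (oct_scale h * oct_scale h' * z0) (oct_scale h * oct_scale h' * z1)
           (oct_scale h * oct_scale h' * z2) (oct_scale h * oct_scale h' * z3))"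
  by (cases x; cases y) (simp add: quat_mult algebra_simps)

lemma oct_quat_mult:
  assumes "oct_mult_ok p q"
  shows "oct_quat p ** oct_quat q = oct_quat (oct_mult p q)"
proof -
  obtain h x h' y where p: "p = (h, x)" and q: "q = (h', y)" by (cases p; cases q)
  obtain z0 z1 z2 z3 where z: "int4_mult x y = (z0, z1, z2, z3)" by (cases "int4_mult x y")
  have "2 dvd z0 \<and> 2 dvd z1 \<and> 2 dvd z2 \<and> 2 dvd z3" if "h \<or> h'"
    using assms that z by (simp add: oct_mult_ok_def p q)
  then show ?thesis
    by (cases h; cases h')
       (simp_all add: p q z oct_quat_mult_int4 oct_mult_def oct_scale_def real_of_int_div mult.commute)
qed

lemma oct_quat_one: "oct_quat oct_one = mat 1"
  by (simp add: oct_one_def oct_scale_def cmat2_eq_iff mat1_entries2 complex_eq_iff)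

lemma oct_conj_mult: "\<forall>q\<in>set binary_octahedral. oct_mult_ok (oct_conj q) q \<and> oct_mult (oct_conj q) q = oct_one"
  by code_simp

definition oct_mat :: "int \<Rightarrow> int \<times> oct \<Rightarrow> cmat2" where
  "oct_mat N = (\<lambda>(j, q). scale_mat (cis (2*pi*(of_int j / of_int N))) (oct_quat q))"

lemma oct_mat_mult:
  "oct_mult_ok p q \<Longrightarrow> oct_mat N (j, p) ** oct_mat N (j', q) = oct_mat N (j + j', oct_mult p q)"
  by (simp add: oct_mat_def scale_mat_mult oct_quat_mult cis_mult add_divide_distrib algebra_simps)

lemma oct_mat_mod: "N > 0 \<Longrightarrow> oct_mat N (j mod N, q) = oct_mat N (j, q)"
proof -
  assume "N > 0"
  have "real_of_int j = of_int N * of_int (j div N) + of_int (j mod N)"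
    by (metis mult_div_mod_eq of_int_add of_int_mult)
  then have "2*pi*(of_int j / of_int N) = 2*pi*(of_int (j mod N) / of_int N) + 2*pi * of_int (j div N)"
    using \<open>N > 0\<close> by (simp add: field_simps)
  then show ?thesis by (simp add: oct_mat_def cis_mult[symmetric])
qed

lemma even_mod_even_iff: "even (N::int) \<Longrightarrow> even (a mod N) \<longleftrightarrow> even a"
  by (metis even_add even_mult_iff mult_div_mod_eq)

lemma oct_mat_one: "oct_mat N (0, oct_one) = mat 1"
  by (simp add: oct_mat_def oct_quat_one cmat2_eq_iff)

text \<open>Quaternions \<open>x/\<surd>2\<close> occur only with odd powers of \<open>cis (2\<pi>/N)\<close>: this holds for the
  generators and is preserved by products, and it cuts down the search.\<close>
definition oct_group :: "int \<Rightarrow> cmat2 set" where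
  "oct_group N = {oct_mat N (j, q) | j q. 0 \<le> j \<and> j < N \<and> q \<in> set binary_octahedral \<and> fst q = even j}"

definition oct_generator :: "oct \<Rightarrow> bool" where
  "oct_generator q \<longleftrightarrow>
     (\<forall>p\<in>set binary_octahedral. oct_mult_ok q p \<and> oct_mult q p \<in> set binary_octahedral \<and>
        oct_mult_ok (oct_conj q) p \<and> oct_mult (oct_conj q) p \<in> set binary_octahedral) \<and>
     oct_mult_ok q (oct_conj q) \<and> oct_mult q (oct_conj q) = oct_one"

lemma oct_group_mult_closed:
  assumes "N > 0" and "even N"
    and q: "\<forall>p\<in>set binary_octahedral. oct_mult_ok q p \<and> oct_mult q p \<in> set binary_octahedral"
    and "fst q = even j" and "X \<in> oct_group N"
  shows "oct_mat N (j, q) ** X \<in> oct_group N"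
proof -
  obtain j' p where X: "X = oct_mat N (j', p)" "p \<in> set binary_octahedral" "fst p = even j'"
    using \<open>X \<in> oct_group N\<close> unfolding oct_group_def by blast
  have "oct_mat N (j, q) ** X = oct_mat N ((j + j') mod N, oct_mult q p)"
    using q X \<open>N > 0\<close> by (simp add: oct_mat_mult oct_mat_mod)
  moreover have "fst (oct_mult q p) = even ((j + j') mod N)"
    using \<open>even N\<close> \<open>fst q = even j\<close> X(3) by (auto simp: oct_mult_def even_mod_even_iff)
  ultimately show ?thesis
    using q X(2) \<open>N > 0\<close> unfolding oct_group_def by fastforce
qed

lemma gen_group_subset_oct_group:
  assumes "N > 0" and "even N" and gens: "\<forall>(j, q)\<in>set gens. fst q = even j \<and> oct_generator q"
  shows "gen_group (oct_mat N ` set gens) \<subseteq> oct_group N"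
proof
  fix g assume "g \<in> gen_group (oct_mat N ` set gens)"
  then show "g \<in> oct_group N"
  proof (induction rule: gen_group.induct)
    case one
    have "mat 1 = oct_mat N (0, oct_one)" by (simp add: oct_mat_one)
    moreover have "oct_one \<in> set binary_octahedral"
      by (simp add: oct_one_def binary_octahedral_def)
    ultimately show ?case
      using \<open>N > 0\<close> unfolding oct_group_def
      by (intro CollectI exI[of _ 0] exI[of _ oct_one]) (simp add: oct_one_def)
  next
    case (mul s g)
    then obtain j q where "s = oct_mat N (j, q)" "(j, q) \<in> set gens" by auto
    moreover from this(2) have "fst q = even j" "oct_generator q" using gens by auto
    ultimately show ?case
      using oct_group_mult_closed[OF assms(1,2)] mul.IH unfolding oct_generator_def by blast
  next
    case (mul_inv s t g)
    then obtain j q where s: "s = oct_mat N (j, q)" "(j, q) \<in> set gens" by auto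
    from s(2) have q: "fst q = even j" "oct_generator q" using gens by auto
    define t' where "t' = oct_mat N (-j, oct_conj q)"
    have "oct_mult_ok q (oct_conj q)" "oct_mult q (oct_conj q) = oct_one"
      using q(2) unfolding oct_generator_def by blast+
    then have "s ** t' = mat 1"
      by (simp add: s(1) t'_def oct_mat_mult oct_mat_one)
    then have "t = t'"
      using \<open>t ** s = mat 1\<close> by (metis matrix_mul_assoc matrix_mul_lid matrix_mul_rid)
    moreover have "fst (oct_conj q) = even (-j)" using q(1) by (cases q) auto
    ultimately show ?case
      using oct_group_mult_closed[OF assms(1,2)] mul_inv.IH q(2) unfolding oct_generator_def t'_def by blast
  qed
qed

text \<open>The real part of an element of the binary octahedral group is \<open>cos (2\<pi> a/24)\<close> with
  \<open>a = oct_angle q\<close>.\<close>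
fun oct_angle :: "oct \<Rightarrow> int" where
  "oct_angle (True, (x0, _)) =
     (if x0 = 2 then 0 else if x0 = 1 then 4 else if x0 = 0 then 6 else if x0 = -1 then 8 else 12)"
| "oct_angle (False, (x0, _)) = (if x0 = 1 then 3 else if x0 = 0 then 6 else 9)"

lemma binary_octahedral_norms:
  "\<forall>(h, x0, x1, x2, x3)\<in>set binary_octahedral.
     x0^2 + x1^2 + x2^2 + x3^2 = (if h then 4 else 2) \<and> (if h then \<bar>x0\<bar> \<le> 2 else \<bar>x0\<bar> \<le> 1)"
  by code_simp

lemma det_oct_quat: "q \<in> set binary_octahedral \<Longrightarrow> det (oct_quat q) = 1"
proof -
  assume "q \<in> set binary_octahedral"
  moreover obtain h x0 x1 x2 x3 where q: "q = (h, x0, x1, x2, x3)" by (metis prod_cases5)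
  ultimately have norm: "of_int (x0^2 + x1^2 + x2^2 + x3^2) = (if h then 4 else (2::real))"
    using binary_octahedral_norms by fastforce
  have "(oct_scale h * x0)^2 + (oct_scale h * x1)^2 + (oct_scale h * x2)^2 + (oct_scale h * x3)^2
        = (oct_scale h)^2 * of_int (x0^2 + x1^2 + x2^2 + x3^2)"
    by (simp add: power_mult_distrib algebra_simps)
  also have "\<dots> = 1"
    using norm by (cases h) (simp_all add: oct_scale_def power_divide)
  finally show ?thesis by (simp add: q det_quat)
qed

lemma trace_oct_quat:
  "q \<in> set binary_octahedral \<Longrightarrow> trace (oct_quat q) = 2 * of_real (cos (2*pi*(of_int (oct_angle q) / 24)))"
proof -
  assume "q \<in> set binary_octahedral"
  moreover obtain h x0 x1 x2 x3 where q: "q = (h, x0, x1, x2, x3)" by (metis prod_cases5)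
  ultimately have "if h then x0 \<in> {-2, -1, 0, 1, 2} else x0 \<in> {-1, 0, 1}"
    using binary_octahedral_norms by fastforce
  then show ?thesis
    by (cases h) (auto simp: q trace_quat oct_scale_def)
qed

definition cos24_eq :: "int \<Rightarrow> int \<Rightarrow> bool" where
  "cos24_eq a c \<longleftrightarrow> 24 dvd (a - c) \<or> 24 dvd (a + c)"

lemma cos24_eq_if_cos_eq:
  assumes "cos (2*pi*(of_int a / 24)) = cos (2*pi*(of_int c / 24))"
  shows "cos24_eq a c"
proof -
  let ?w = "2*pi*(of_int a / 24)" and ?z = "2*pi*(of_int c / 24)"
  have "sin ((?w + ?z) / 2) = 0 \<or> sin ((?z - ?w) / 2) = 0"
    using assms cos_diff_cos[of ?w ?z] by simp
  then show ?thesis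
  proof
    assume "sin ((?w + ?z) / 2) = 0"
    then obtain i :: int where "(?w + ?z) / 2 = i * pi" using sin_zero_iff_int2 by blast
    then have "pi * real_of_int (a + c) = pi * of_int (24 * i)" by (simp add: field_simps)
    then have "real_of_int (a + c) = of_int (24 * i)" by simp
    then have "a + c = 24 * i" by (simp only: of_int_eq_iff)
    then show ?thesis unfolding cos24_eq_def by simp
  next
    assume "sin ((?z - ?w) / 2) = 0"
    then obtain i :: int where "(?z - ?w) / 2 = i * pi" using sin_zero_iff_int2 by blast
    then have "pi * real_of_int (c - a) = pi * of_int (24 * i)" by (simp add: field_simps)
    then have "real_of_int (c - a) = of_int (24 * i)" by simp
    then have "a - c = 24 * (-i)" by simp
    then show ?thesis unfolding cos24_eq_def by (metis dvd_triv_left)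
  qed
qed
definition oct_refl_candidate :: "int \<Rightarrow> int \<times> oct \<Rightarrow> bool" where
  "oct_refl_candidate N = (\<lambda>(j, q). cos24_eq (j * (24 div N)) (oct_angle q) \<and> \<not> N dvd 2 * j)"

lemma oct_refl_candidate_if_reflection:
  assumes "N > 0" and "N dvd 24" and "q \<in> set binary_octahedral"
    and r: "is_reflection (oct_mat N (j, q))"
  shows "oct_refl_candidate N (j, q)"
proof -
  obtain k where k: "24 = N * k" using \<open>N dvd 24\<close> by (elim dvdE)
  then have kdiv: "24 div N = k" and kreal: "(24::real) = of_int N * of_int k"
    using \<open>N > 0\<close> by (metis nonzero_mult_div_cancel_left less_irrefl, simp flip: of_int_mult)
  have angle: "of_int j / of_int N = (of_int (j * (24 div N)) / 24 :: real)"
    unfolding kdiv kreal using \<open>N > 0\<close> k by (cases "k = 0") (simp_all add: field_simps)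
  have r': "is_reflection (scale_mat (cis (2*pi*(of_int j / of_int N))) (oct_quat q))"
    using r by (simp add: oct_mat_def)
  note crit = reflection_scale_mat_unimodular[OF r' det_oct_quat[OF \<open>q \<in> _\<close>]
      trace_oct_quat[OF \<open>q \<in> _\<close>]]
  have "cos24_eq (j * (24 div N)) (oct_angle q)"
    using crit(1) unfolding angle by (intro cos24_eq_if_cos_eq) simp
  moreover have "\<not> N dvd 2 * j"
    using crit(2) cis_2pi_eq_1_iff[OF \<open>N > 0\<close>, of "2 * j"] by (simp add: algebra_simps)
  ultimately show ?thesis by (simp add: oct_refl_candidate_def)
qed

text \<open>A certificate that \<open>g = oct_mat N (j\<^sub>g, q\<^sub>g)\<close> is not \<open>1\<close> (an off-diagonal entry is nonzero), not a
  reflection, and not \<open>r r'\<close> with \<open>r\<close> a reflection in \<open>oct_group N\<close> and \<open>r'\<close> a reflection: for every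
  candidate \<open>r\<close>, the quotient \<open>r\<^sup>-\<^sup>1 g\<close> fails the reflection criterion.\<close>
definition oct_long_witness :: "int \<Rightarrow> int \<times> oct \<Rightarrow> bool" where
  "oct_long_witness N = (\<lambda>(jg, qg).
     (case qg of (_, _, _, x2, x3) \<Rightarrow> x2 \<noteq> 0 \<or> x3 \<noteq> 0) \<and> qg \<in> set binary_octahedral \<and>
     \<not> oct_refl_candidate N (jg, qg) \<and>
     (\<forall>j\<in>set [0..N-1]. \<forall>q\<in>set binary_octahedral. fst q = even j \<and> oct_refl_candidate N (j, q) \<longrightarrow>
        oct_mult_ok (oct_conj q) qg \<and> oct_mult (oct_conj q) qg \<in> set binary_octahedral \<and>
        \<not> oct_refl_candidate N (jg - j, oct_mult (oct_conj q) qg)))"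

lemma oct_mat_neq_mat1:
  assumes "case q of (_, _, _, x2, x3) \<Rightarrow> x2 \<noteq> 0 \<or> x3 \<noteq> 0"
  shows "oct_mat N (j, q) \<noteq> mat 1"
proof
  assume "oct_mat N (j, q) = mat 1"
  then have "oct_mat N (j, q) $1$2 = 0" by (simp add: mat1_entries2)
  moreover obtain h x0 x1 x2 x3 where q: "q = (h, x0, x1, x2, x3)" by (metis prod_cases5)
  moreover have "oct_scale h \<noteq> 0" by (simp add: oct_scale_def)
  ultimately have "x2 = 0" "x3 = 0" by (simp_all add: oct_mat_def Complex_eq_0)
  then show False using assms q by simp
qed

lemma oct_long_witness_not_reflection_mult:
  assumes N: "N > 0" "N dvd 24" and wit: "oct_long_witness N (jg, qg)"
    and r1: "r1 \<in> oct_group N" "is_reflection r1" and r2: "is_reflection r2"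
  shows "r1 ** r2 \<noteq> oct_mat N (jg, qg)"
proof
  assume prod: "r1 ** r2 = oct_mat N (jg, qg)"
  obtain j q where r1_eq: "r1 = oct_mat N (j, q)" and j: "0 \<le> j" "j < N"
    and q: "q \<in> set binary_octahedral" "fst q = even j"
    using r1(1) unfolding oct_group_def by blast
  have "oct_refl_candidate N (j, q)"
    using oct_refl_candidate_if_reflection[OF N q(1)] r1 r1_eq by blast
  moreover have "j \<in> set [0..N-1]" using j by simp
  ultimately have quot: "oct_mult_ok (oct_conj q) qg"
      "\<not> oct_refl_candidate N (jg - j, oct_mult (oct_conj q) qg)"
      "oct_mult (oct_conj q) qg \<in> set binary_octahedral"
    using wit q unfolding oct_long_witness_def prod.case by blast+
  have "oct_mat N (-j, oct_conj q) ** r1 = mat 1"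
    using oct_conj_mult q(1) by (simp add: r1_eq oct_mat_mult oct_mat_one)
  then have "r2 = oct_mat N (-j, oct_conj q) ** oct_mat N (jg, qg)"
    by (metis prod matrix_mul_assoc matrix_mul_lid)
  also have "\<dots> = oct_mat N (jg - j, oct_mult (oct_conj q) qg)"
    using quot(1) by (simp add: oct_mat_mult)
  finally show False
    using r2 oct_refl_candidate_if_reflection[OF N quot(3)] quot(2) by metis
qed

fun oct_word :: "(int \<times> oct) list \<Rightarrow> (int \<times> oct) option" where
  "oct_word [] = Some (0, oct_one)"
| "oct_word ((j, p) # ws) =
     (case oct_word ws of
        None \<Rightarrow> None
      | Some (j', q) \<Rightarrow> if oct_mult_ok p q then Some (j + j', oct_mult p q) else None)"

lemma foldr_oct_mat: "oct_word ws = Some g \<Longrightarrow> foldr (**) (map (oct_mat N) ws) (mat 1) = oct_mat N g"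
proof (induction ws arbitrary: g)
  case Nil
  then show ?case using oct_mat_one by auto
next
  case (Cons jp ws)
  obtain j p where "jp = (j, p)" by (cases jp)
  with Cons show ?case by (auto simp: oct_mat_mult split: option.splits if_splits)
qed

lemma long_element_octahedral:
  assumes S: "S = oct_mat N ` set gens" and refl: "\<forall>s\<in>S. is_reflection s"
    and N: "N > 0" "even N" "N dvd 24"
    and gens: "\<forall>(j, q)\<in>set gens. fst q = even j \<and> oct_generator q"
    and "set ws \<subseteq> set gens"
    and witness: "case oct_word ws of Some g \<Rightarrow> oct_long_witness N g | None \<Rightarrow> False"
  shows "\<exists>g \<in> gen_group S. codim g < refl_length (gen_group S) g"
proof -
  obtain jg qg where word: "oct_word ws = Some (jg, qg)" and wit: "oct_long_witness N (jg, qg)"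
    using witness by (cases "oct_word ws") (auto split: prod.splits)
  have qg: "qg \<in> set binary_octahedral" "\<not> oct_refl_candidate N (jg, qg)"
    and offdiag: "case qg of (_, _, _, x2, x3) \<Rightarrow> x2 \<noteq> 0 \<or> x3 \<noteq> 0"
    using wit unfolding oct_long_witness_def prod.case by blast+
  show ?thesis
  proof (rule long_element_in_gen_group[OF refl, of "map (oct_mat N) ws"])
    show "set (map (oct_mat N) ws) \<subseteq> S" using \<open>set ws \<subseteq> set gens\<close> S by auto
    show "oct_mat N (jg, qg) = foldr (**) (map (oct_mat N) ws) (mat 1)"
      using foldr_oct_mat[OF word] by simp
    show "oct_mat N (jg, qg) \<noteq> mat 1" using offdiag by (rule oct_mat_neq_mat1)
    show "\<not> is_reflection (oct_mat N (jg, qg))"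
      using oct_refl_candidate_if_reflection[OF N(1,3) qg(1)] qg(2) by blast
    fix r1 r2 assume "r1 \<in> gen_group S" "is_reflection r1" "is_reflection r2"
    moreover have "gen_group S \<subseteq> oct_group N"
      unfolding S using gen_group_subset_oct_group[OF N(1,2) gens] .
    ultimately show "r1 ** r2 \<noteq> oct_mat N (jg, qg)"
      using oct_long_witness_not_reflection_mult[OF N(1,3) wit] by blast
  qed
qed

section \<open>The groups \<open>G\<^sub>4\<close>, ..., \<open>G\<^sub>2\<^sub>2\<close>\<close>

lemma ST_group_4_long_element: "\<exists>g \<in> ST_group 4. codim g < refl_length (ST_group 4) g"
  unfolding ST_group_def
  by (rule long_element_of_generator_pair[where e=3 and n=2 and P=1 and Q=4 and T=4
        and k=1 and m=3 and a="-1/2" and b="1/2" and c="-1/2" and d="-1/2"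
        and k'=2 and m'=3 and a'="-1/2" and b'="1/2" and c'="-1/2" and d'="1/2"])
     (auto simp: ST_gens_list_def tau_fractions intro!: is_reflection_refl_gen det_refl_gen_pow_eq_1,
      simp_all add: power2_eq_square field_simps)

lemma ST_group_5_long_element: "\<exists>g \<in> ST_group 5. codim g < refl_length (ST_group 5) g"
  unfolding ST_group_def
  by (rule long_element_of_generator_pair[where e=3 and n=2 and P=3 and Q=12 and T=16
        and k=2 and m=3 and a="-1/2" and b="-1/2" and c="-1/2" and d="-1/2"
        and k'=2 and m'=3 and a'="-1/2" and b'="1/2" and c'="-1/2" and d'="-1/2"])
     (auto simp: ST_gens_list_def tau_fractions intro!: is_reflection_refl_gen det_refl_gen_pow_eq_1,
      simp_all add: power2_eq_square field_simps)

lemma ST_group_6_long_element: "\<exists>g \<in> ST_group 6. codim g < refl_length (ST_group 6) g"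
  unfolding ST_group_def
  by (rule long_element_of_generator_pair[where e=6 and n=3 and P=2 and Q=12 and T=7
        and k=1 and m=4 and a="0" and b="0" and c="0" and d="1"
        and k'=1 and m'=3 and a'="-1/2" and b'="-1/2" and c'="-1/2" and d'="-1/2"])
     (auto simp: ST_gens_list_def tau_fractions intro!: is_reflection_refl_gen det_refl_gen_pow_eq_1,
      simp_all add: power2_eq_square field_simps)

lemma ST_group_7_long_element: "\<exists>g \<in> ST_group 7. codim g < refl_length (ST_group 7) g"
  unfolding ST_group_def
  by (rule long_element_of_generator_pair[where e=6 and n=3 and P=4 and Q=12 and T=11
        and k=2 and m=3 and a="-1/2" and b="-1/2" and c="-1/2" and d="-1/2"
        and k'=1 and m'=4 and a'="0" and b'="-1" and c'="0" and d'="0"])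
     (auto simp: ST_gens_list_def tau_fractions intro!: is_reflection_refl_gen det_refl_gen_pow_eq_1,
      simp_all add: power2_eq_square field_simps)

lemma ST_group_9_long_element: "\<exists>g \<in> ST_group 9. codim g < refl_length (ST_group 9) g"
  unfolding ST_group_def
  by (rule long_element_of_generator_pair[where e=4 and n=3 and P=4 and Q=24 and T=9
        and k=1 and m=8 and a="1/sqrt 2" and b="1/sqrt 2" and c="0" and d="0"
        and k'=1 and m'=4 and a'="0" and b'="-1/sqrt 2" and c'="0" and d'="1/sqrt 2"])
     (auto simp: ST_gens_list_def tau_fractions intro!: is_reflection_refl_gen det_refl_gen_pow_eq_1,
      simp_all add: power2_eq_square field_simps)

lemma ST_group_11_long_element: "\<exists>g \<in> ST_group 11. codim g < refl_length (ST_group 11) g"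
  unfolding ST_group_def
  by (rule long_element_of_generator_pair[where e=12 and n=3 and P=4 and Q=24 and T=9
        and k=1 and m=8 and a="1/sqrt 2" and b="0" and c="0" and d="1/sqrt 2"
        and k'=1 and m'=4 and a'="0" and b'="-1/sqrt 2" and c'="0" and d'="-1/sqrt 2"])
     (auto simp: ST_gens_list_def tau_fractions intro!: is_reflection_refl_gen det_refl_gen_pow_eq_1,
      simp_all add: power2_eq_square field_simps)

lemma ST_group_15_long_element: "\<exists>g \<in> ST_group 15. codim g < refl_length (ST_group 15) g"
  unfolding ST_group_def
  by (rule long_element_of_generator_pair[where e=6 and n=3 and P=4 and Q=12 and T=11
        and k=1 and m=4 and a="0" and b="1" and c="0" and d="0"
        and k'=2 and m'=3 and a'="-1/2" and b'="1/2" and c'="-1/2" and d'="-1/2"])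
     (auto simp: ST_gens_list_def tau_fractions intro!: is_reflection_refl_gen det_refl_gen_pow_eq_1,
      simp_all add: power2_eq_square field_simps)

lemma ST_group_16_long_element: "\<exists>g \<in> ST_group 16. codim g < refl_length (ST_group 16) g"
  unfolding ST_group_def
  by (rule long_element_of_generator_pair[where e=5 and n=3 and P=1 and Q=6 and T=6
        and k=1 and m=5 and a="1/(2*tau)" and b="1/2" and c="-tau/2" and d="0"
        and k'=4 and m'=5 and a'="1/(2*tau)" and b'="0" and c'="1/2" and d'="-tau/2"])
     (auto simp: ST_gens_list_def tau_fractions intro!: is_reflection_refl_gen det_refl_gen_pow_eq_1,
      simp_all add: power2_eq_square field_simps)

lemma ST_group_17_long_element: "\<exists>g \<in> ST_group 17. codim g < refl_length (ST_group 17) g"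
  unfolding ST_group_def
  by (rule long_element_of_generator_pair[where e=10 and n=3 and P=20 and Q=60 and T=27
        and k=1 and m=4 and a="0" and b="tau/2" and c="1/2" and d="-1/(2*tau)"
        and k'=1 and m'=5 and a'="1/(2*tau)" and b'="tau/2" and c'="0" and d'="1/2"])
     (auto simp: ST_gens_list_def tau_fractions intro!: is_reflection_refl_gen det_refl_gen_pow_eq_1,
      simp_all add: power2_eq_square field_simps)

lemma ST_group_18_long_element: "\<exists>g \<in> ST_group 18. codim g < refl_length (ST_group 18) g"
  unfolding ST_group_def
  by (rule long_element_of_generator_pair[where e=15 and n=3 and P=5 and Q=30 and T=16
        and k=1 and m=3 and a="-1/2" and b="-1/(2*tau)" and c="0" and d="tau/2"
        and k'=1 and m'=5 and a'="1/(2*tau)" and b'="0" and c'="1/2" and d'="-tau/2"])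
     (auto simp: ST_gens_list_def tau_fractions intro!: is_reflection_refl_gen det_refl_gen_pow_eq_1,
      simp_all add: power2_eq_square field_simps)

lemma ST_group_19_long_element: "\<exists>g \<in> ST_group 19. codim g < refl_length (ST_group 19) g"
  unfolding ST_group_def
  by (rule long_element_of_generator_pair[where e=30 and n=5 and P=12 and Q=60 and T=55
        and k=2 and m=3 and a="-1/2" and b="-1/2" and c="-1/2" and d="-1/2"
        and k'=1 and m'=4 and a'="0" and b'="1/(2*tau)" and c'="tau/2" and d'="-1/2"])
     (auto simp: ST_gens_list_def tau_fractions intro!: is_reflection_refl_gen det_refl_gen_pow_eq_1,
      simp_all add: power2_eq_square field_simps)

lemma ST_group_20_long_element: "\<exists>g \<in> ST_group 20. codim g < refl_length (ST_group 20) g"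
  unfolding ST_group_def
  by (rule long_element_of_generator_pair[where e=3 and n=5 and P=3 and Q=10 and T=10
        and k=1 and m=3 and a="-1/2" and b="tau/2" and c="-1/(2*tau)" and d="0"
        and k'=2 and m'=3 and a'="-1/2" and b'="1/2" and c'="-1/2" and d'="-1/2"])
     (auto simp: ST_gens_list_def tau_fractions intro!: is_reflection_refl_gen det_refl_gen_pow_eq_1,
      simp_all add: power2_eq_square field_simps)

lemma ST_group_21_long_element: "\<exists>g \<in> ST_group 21. codim g < refl_length (ST_group 21) g"
  unfolding ST_group_def
  by (rule long_element_of_generator_pair[where e=6 and n=3 and P=4 and Q=12 and T=11
        and k=2 and m=3 and a="-1/2" and b="-1/2" and c="1/2" and d="-1/2"
        and k'=1 and m'=4 and a'="0" and b'="0" and c'="0" and d'="-1"])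
     (auto simp: ST_gens_list_def tau_fractions intro!: is_reflection_refl_gen det_refl_gen_pow_eq_1,
      simp_all add: power2_eq_square field_simps)

lemma ST_group_12_long_element: "\<exists>g \<in> ST_group 12. codim g < refl_length (ST_group 12) g"
  unfolding ST_group_def
  by (rule long_element_of_det_minus_one[where w="ST_gens_list ! (12 - 4)"])
     (auto simp: ST_gens_list_def tau_fractions intro!: is_reflection_refl_gen det_refl_gen_pow_eq_1,
      simp_all add: refl_gen_eq_scale_mat scale_mat_mult quat_mult trace_scale_mat trace_quat
        power2_eq_square field_simps)

lemma ST_group_13_long_element: "\<exists>g \<in> ST_group 13. codim g < refl_length (ST_group 13) g"
  unfolding ST_group_def
  by (rule long_element_of_det_minus_one[where w="ST_gens_list ! (13 - 4)"])
     (auto simp: ST_gens_list_def tau_fractions intro!: is_reflection_refl_gen det_refl_gen_pow_eq_1,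
      simp_all add: refl_gen_eq_scale_mat scale_mat_mult quat_mult trace_scale_mat trace_quat
        power2_eq_square field_simps)

lemma ST_group_22_long_element: "\<exists>g \<in> ST_group 22. codim g < refl_length (ST_group 22) g"
  unfolding ST_group_def
  by (rule long_element_of_det_minus_one[where w="ST_gens_list ! (22 - 4)"])
     (auto simp: ST_gens_list_def tau_fractions intro!: is_reflection_refl_gen det_refl_gen_pow_eq_1,
      simp_all add: refl_gen_eq_scale_mat scale_mat_mult quat_mult trace_scale_mat trace_quat
        power2_eq_square field_simps complex_eq_iff,
      use real_sqrt_ge_zero[of 5] in linarith)

lemma ST_group_8_long_element: "\<exists>g \<in> ST_group 8. codim g < refl_length (ST_group 8) g"
proof -
  have "set (ST_gens_list ! (8 - 4)) = oct_mat 8 ` set [(3, False, -1, 1, 0, 0), (1, False, 1, 0, 0, 1)]"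
    by (simp add: ST_gens_list_def refl_gen_eq_scale_mat oct_mat_def oct_scale_def mult.commute[of pi])
  moreover have "\<forall>s\<in>set (ST_gens_list ! (8 - 4)). is_reflection s"
    by (auto simp: ST_gens_list_def intro!: is_reflection_refl_gen,
        simp_all add: power2_eq_square field_simps)
  ultimately show ?thesis
    unfolding ST_group_def
    by (rule long_element_octahedral[where ws =
          "[(3, False, -1, 1, 0, 0), (1, False, 1, 0, 0, 1), (3, False, -1, 1, 0, 0), (1, False, 1, 0, 0, 1)]"])
       code_simp+
qed

lemma ST_group_10_long_element: "\<exists>g \<in> ST_group 10. codim g < refl_length (ST_group 10) g"
proof -
  have "set (ST_gens_list ! (10 - 4)) =
      oct_mat 24 ` set [(16, True, -1, 1, -1, -1), (8, True, -1, -1, -1, -1), (3, False, 1, 0, -1, 0)]"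
    by (simp add: ST_gens_list_def refl_gen_eq_scale_mat oct_mat_def oct_scale_def mult.commute[of pi])
  moreover have "\<forall>s\<in>set (ST_gens_list ! (10 - 4)). is_reflection s"
    by (auto simp: ST_gens_list_def intro!: is_reflection_refl_gen,
        simp_all add: power2_eq_square field_simps)
  ultimately show ?thesis
    unfolding ST_group_def
    by (rule long_element_octahedral[where ws =
          "[(16, True, -1, 1, -1, -1), (16, True, -1, 1, -1, -1), (3, False, 1, 0, -1, 0), (8, True, -1, -1, -1, -1)]"])
       code_simp+
qed

lemma ST_group_14_long_element: "\<exists>g \<in> ST_group 14. codim g < refl_length (ST_group 14) g"
proof -
  have "set (ST_gens_list ! (14 - 4)) =
      oct_mat 12 ` set [(4, True, -1, -1, 1, 1), (8, True, -1, -1, -1, 1), (3, False, 0, -1, 0, 1)]"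
    by (simp add: ST_gens_list_def refl_gen_eq_scale_mat oct_mat_def oct_scale_def mult.commute[of pi])
  moreover have "\<forall>s\<in>set (ST_gens_list ! (14 - 4)). is_reflection s"
    by (auto simp: ST_gens_list_def intro!: is_reflection_refl_gen,
        simp_all add: power2_eq_square field_simps)
  ultimately show ?thesis
    unfolding ST_group_def
    by (rule long_element_octahedral[where ws =
          "[(4, True, -1, -1, 1, 1), (8, True, -1, -1, -1, 1), (3, False, 0, -1, 0, 1)]"])
       code_simp+
qed

theorem mainTheorem11:
  shows "\<forall>n \<in> {4..22::nat}. \<exists>g \<in> ST_group n. refl_length (ST_group n) g > codim g"
proof
  fix n :: nat
  assume "n \<in> {4..22}"
  then have "n = 4 \<or> n = 5 \<or> n = 6 \<or> n = 7 \<or> n = 8 \<or> n = 9 \<or> n = 10 \<or> n = 11 \<or> n = 12 \<or>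
      n = 13 \<or> n = 14 \<or> n = 15 \<or> n = 16 \<or> n = 17 \<or> n = 18 \<or> n = 19 \<or> n = 20 \<or> n = 21 \<or> n = 22"
    by auto presburger
  then show "\<exists>g \<in> ST_group n. refl_length (ST_group n) g > codim g"
    using ST_group_4_long_element ST_group_5_long_element ST_group_6_long_element
      ST_group_7_long_element ST_group_8_long_element ST_group_9_long_element
      ST_group_10_long_element ST_group_11_long_element ST_group_12_long_element
      ST_group_13_long_element ST_group_14_long_element ST_group_15_long_element
      ST_group_16_long_element ST_group_17_long_element ST_group_18_long_element
      ST_group_19_long_element ST_group_20_long_element ST_group_21_long_element
      ST_group_22_long_element
    by auto
qed

end
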